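(* Let $\mathcal{H}$ be a real Hilbert space, let $G:\mathcal{H}\to\mathcal{H}$ and let $\gamma\in[0,1[$. Suppose that $G$ is a $\gamma$-BAM. Then $G$ is linearly regular with constant $\frac{1}{1-\gamma}$.
   Context: For a nonempty closed convex set $C\subseteq\mathcal{H}$, $\mathrm{P}_C$ denotes the metric projection onto $C$ and $\mathrm{d}_C(x)=\|x-\mathrm{P}_Cx\|$ the distance to $C$. $\operatorname{Fix}G=\{x\in\mathcal{H}: Gx=x\}$. Definition (BAM). Let $G:\mathcal{H}\to\mathcal{H}$ and $\gamma\in[0,1[$. $G$ is a best approximation mapping with constant $\gamma$ ($\gamma$-BAM) if (1) $\operatorname{Fix}G$ is a nonempty closed convex subset of $\mathcal{H}$; (2) $\mathrm{P}_{\operatorname{Fix}G}G=\mathrm{P}_{\operatorname{Fix}G}$; (3) $\|Gx-\mathrm{P}_{\operatorname{Fix}G}x\|\le\gamma\|x-\mathrm{P}_{\operatorname{Fix}G}x\|$ for all $x\in\mathcal{H}$. Definition (linear regularity). $T:\mathcal{H}\to\mathcal{H}$ with $\operatorname{Fix}T\neq\varnothing$ is linearly regular with constant $\kappa\ge 0$ if $\mathrm{d}_{\operatorname{Fix}T}(x)\le\kappa\|x-Tx\|$ for all $x\in\mathcal{H}$. *)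

theory Defs
  imports "HOL-Analysis.Analysis"
begin

text \<open>Real Hilbert spaces are types of sort \<open>{real_inner, complete_space}\<close>. The library's
  \<open>closest_point\<close> is restricted to class \<open>heine_borel\<close> (finite dimension), so the metric
  projection is introduced here.\<close>

definition metric_proj :: "'a::{real_inner,complete_space} set \<Rightarrow> 'a \<Rightarrow> 'a" where
  "metric_proj C x = (THE p. p \<in> C \<and> (\<forall>y\<in>C. dist x p \<le> dist x y))"

definition proj_dist :: "'a::{real_inner,complete_space} set \<Rightarrow> 'a \<Rightarrow> real" where
  "proj_dist C x = norm (x - metric_proj C x)"

definition Fix :: "('a \<Rightarrow> 'a) \<Rightarrow> 'a set" where
  "Fix T = {x. T x = x}"

definition BAM :: "real \<Rightarrow> ('a::{real_inner,complete_space} \<Rightarrow> 'a) \<Rightarrow> bool" where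
  "BAM \<gamma> G \<longleftrightarrow> 0 \<le> \<gamma> \<and> \<gamma> < 1 \<and>
     Fix G \<noteq> {} \<and> closed (Fix G) \<and> convex (Fix G) \<and>
     metric_proj (Fix G) \<circ> G = metric_proj (Fix G) \<and>
     (\<forall>x. norm (G x - metric_proj (Fix G) x) \<le> \<gamma> * norm (x - metric_proj (Fix G) x))"

definition linearly_regular :: "real \<Rightarrow> ('a::{real_inner,complete_space} \<Rightarrow> 'a) \<Rightarrow> bool" where
  "linearly_regular \<kappa> T \<longleftrightarrow> 0 \<le> \<kappa> \<and> Fix T \<noteq> {} \<and>
     (\<forall>x. proj_dist (Fix T) x \<le> \<kappa> * norm (x - T x))"

text \<open>The definite description in \<open>metric_proj\<close> denotes on nonempty closed convex sets,
  where \<open>proj_dist\<close> coincides with \<open>infdist\<close>; for other sets both values are unspecified.\<close>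

lemma dist_midpoint_convex:
  fixes C :: "'a::real_inner set"
  assumes "convex C" "y \<in> C" "z \<in> C"
  shows "(dist y z)\<^sup>2 \<le> 2 * (dist x y)\<^sup>2 + 2 * (dist x z)\<^sup>2 - 4 * (infdist x C)\<^sup>2"
proof -
  define m where "m = (1/2) *\<^sub>R y + (1/2) *\<^sub>R z"
  have "m \<in> C"
    unfolding m_def by (rule convexD[OF assms]) auto
  then have "infdist x C \<le> dist x m"
    by (rule infdist_le)
  then have le: "(infdist x C)\<^sup>2 \<le> (dist x m)\<^sup>2"
    by (intro power_mono infdist_nonneg)
  have "(dist y z)\<^sup>2 = 2 * (dist x y)\<^sup>2 + 2 * (dist x z)\<^sup>2 - 4 * (dist x m)\<^sup>2"
    by (simp add: dist_norm power2_norm_eq_inner m_def inner_simps inner_commute algebra_simps)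
  with le show ?thesis by linarith
qed

lemma metric_proj_exists1:
  fixes C :: "'a::{real_inner,complete_space} set"
  assumes "C \<noteq> {}" "closed C" "convex C"
  shows "\<exists>!p. p \<in> C \<and> (\<forall>y\<in>C. dist x p \<le> dist x y)"
proof -
  define d where "d = infdist x C"
  have d0: "0 \<le> d" by (simp add: d_def infdist_nonneg)
  have d_eq: "d = (INF a\<in>C. dist x a)" using assms(1) by (simp add: d_def infdist_def)
  have "\<exists>y\<in>C. dist x y < d + 1 / real (Suc n)" for n
  proof -
    have "(INF a\<in>C. dist x a) < d + 1 / real (Suc n)" by (simp add: d_eq)
    then show ?thesis using assms(1) by (subst (asm) cINF_less_iff) auto
  qed
  then obtain u where uC: "\<And>n. u n \<in> C" and ud: "\<And>n. dist x (u n) < d + 1 / real (Suc n)"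
    by metis
  have close: "(dist (u m) (u n))\<^sup>2 \<le> 4 * (2 * d + 1) / real (Suc N)"
    if "N \<le> m" "N \<le> n" for m n N
  proof -
    define e where "e = 1 / real (Suc N)"
    have e: "0 \<le> e" "e \<le> 1" by (auto simp: e_def)
    have b: "dist x (u k) \<le> d + e" if "N \<le> k" for k
    proof -
      have "1 / real (Suc k) \<le> e" using that by (simp add: e_def frac_le)
      with ud[of k] show ?thesis by linarith
    qed
    have "(dist x (u m))\<^sup>2 \<le> (d + e)\<^sup>2" "(dist x (u n))\<^sup>2 \<le> (d + e)\<^sup>2"
      using b that by (auto intro!: power_mono)
    then have "(dist (u m) (u n))\<^sup>2 \<le> 4 * (d + e)\<^sup>2 - 4 * d\<^sup>2"
      using dist_midpoint_convex[OF assms(3) uC uC, of m n x] by (simp add: d_def)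
    also have "\<dots> = 4 * (2 * d + e) * e" by (simp add: power2_eq_square algebra_simps)
    also have "\<dots> \<le> 4 * (2 * d + 1) * e" using e by (intro mult_right_mono) auto
    finally show ?thesis by (simp add: e_def)
  qed
  have "Cauchy u"
  proof (rule metric_CauchyI)
    fix e :: real assume e: "0 < e"
    obtain N where N: "4 * (2 * d + 1) / e\<^sup>2 < real N" using reals_Archimedean2 by blast
    have "4 * (2 * d + 1) < real (Suc N) * e\<^sup>2"
      using N e by (simp add: divide_less_eq algebra_simps) (smt (verit) zero_le_power2)
    then have "4 * (2 * d + 1) / real (Suc N) < e\<^sup>2"
      by (simp add: divide_less_eq mult.commute)
    then have "\<forall>m\<ge>N. \<forall>n\<ge>N. (dist (u m) (u n))\<^sup>2 < e\<^sup>2"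
      using close by (meson le_less_trans)
    then show "\<exists>N. \<forall>m\<ge>N. \<forall>n\<ge>N. dist (u m) (u n) < e"
      using e by (meson less_imp_le power_less_imp_less_base)
  qed
  then obtain p where p: "u \<longlonglongrightarrow> p"
    using Cauchy_convergent convergent_def by blast
  have pC: "p \<in> C"
    using assms(2) uC p closed_sequentially by blast
  have "dist x p \<le> d"
  proof (rule LIMSEQ_le)
    show "(\<lambda>n. dist x (u n)) \<longlonglongrightarrow> dist x p" by (intro tendsto_intros p)
    show "(\<lambda>n. d + 1 / real (Suc n)) \<longlonglongrightarrow> d"
      using tendsto_add[OF tendsto_const[of d] LIMSEQ_inverse_real_of_nat]
      by (simp add: inverse_eq_divide)
    show "\<exists>N. \<forall>n\<ge>N. dist x (u n) \<le> d + 1 / real (Suc n)" using ud less_imp_le by blast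
  qed
  then have pmin: "\<forall>y\<in>C. dist x p \<le> dist x y"
    unfolding d_def using infdist_le order_trans by blast
  show ?thesis
  proof (rule ex1I[of _ p])
    show "p \<in> C \<and> (\<forall>y\<in>C. dist x p \<le> dist x y)" using pC pmin by blast
  next
    fix q assume q: "q \<in> C \<and> (\<forall>y\<in>C. dist x q \<le> dist x y)"
    have "dist x q \<le> d" using q pC \<open>dist x p \<le> d\<close> by force
    then have "(dist x q)\<^sup>2 \<le> d\<^sup>2" "(dist x p)\<^sup>2 \<le> d\<^sup>2"
      using \<open>dist x p \<le> d\<close> by (auto intro!: power_mono)
    then have "(dist q p)\<^sup>2 \<le> 0"
      using dist_midpoint_convex[OF assms(3), of q p x] q pC unfolding d_def by linarith
    then show "q = p" by simp
  qed
qed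

lemma metric_proj:
  fixes C :: "'a::{real_inner,complete_space} set"
  assumes "C \<noteq> {}" "closed C" "convex C"
  shows metric_proj_in: "metric_proj C x \<in> C"
    and metric_proj_le: "y \<in> C \<Longrightarrow> dist x (metric_proj C x) \<le> dist x y"
  using theI'[OF metric_proj_exists1[OF assms, of x]] unfolding metric_proj_def by auto

lemma proj_dist_eq_infdist:
  fixes C :: "'a::{real_inner,complete_space} set"
  assumes "C \<noteq> {}" "closed C" "convex C"
  shows "proj_dist C x = infdist x C"
proof (rule antisym)
  show "proj_dist C x \<le> infdist x C"
    using metric_proj_le[OF assms, of _ x] assms(1)
    by (auto simp: infdist_def proj_dist_def dist_norm intro!: cINF_greatest)
  show "infdist x C \<le> proj_dist C x"
    using infdist_le[OF metric_proj_in[OF assms], of x x] by (simp add: proj_dist_def dist_norm)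
qed

end

theory Submission
  imports Defs
begin

text \<open>Going from x to its projection p via G x costs at most |x - G x| + |G x - p|, and the
  BAM inequality bounds the last term by \<gamma> |x - p|. Since \<gamma> < 1, this term can be
  absorbed on the left.\<close>

theorem proposition3p15:
  fixes G :: "'a::{real_inner,complete_space} \<Rightarrow> 'a" and \<gamma> :: real
  assumes "0 \<le> \<gamma>" and "\<gamma> < 1"
    and "BAM \<gamma> G"
  shows "linearly_regular (1 / (1 - \<gamma>)) G"
  unfolding linearly_regular_def
proof (intro conjI allI)
  show "0 \<le> 1 / (1 - \<gamma>)" using assms(2) by simp
  show "Fix G \<noteq> {}" using assms(3) by (simp add: BAM_def)
next
  fix x
  let ?p = "metric_proj (Fix G) x"
  have "norm (x - ?p) \<le> norm (x - G x) + norm (G x - ?p)"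
    using norm_triangle_ineq[of "x - G x" "G x - ?p"] by simp
  also have "norm (G x - ?p) \<le> \<gamma> * norm (x - ?p)"
    using assms(3) by (simp add: BAM_def)
  finally have "(1 - \<gamma>) * norm (x - ?p) \<le> norm (x - G x)"
    by (simp add: algebra_simps)
  \<comment> \<open>Dividing by 1 - \<gamma> > 0 yields the constant; \<open>norm (x - ?p)\<close>
    is \<open>proj_dist (Fix G) x\<close> by definition.\<close>
  then show "proj_dist (Fix G) x \<le> 1 / (1 - \<gamma>) * norm (x - G x)"
    using assms(2) by (simp add: proj_dist_def field_simps)
qed

end
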